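(* For $N\in\mathbb{N}$ and $K\ge 1$, let $P_{AC}(N,K)$ denote the supremum of $\sup_{n\ge 1}\|A^n\|$ over all complex $N\times N$ matrices $A$ that are absolutely Cesàro bounded with constant at most $K$. (i) Let $\varepsilon>0$ and $m\in\mathbb{N}$. There exists a constant $C=C(\varepsilon,m)>0$ such that for all integers $N\ge 1$, $$P_{AC}(N,1+\varepsilon)\ge C\,(\log N)^m .$$ (ii) Let $\alpha\in(0,\tfrac14)$. There exist $M=M(\alpha)>0$ and $\varepsilon_0\in(0,1]$ such that, whenever $0<\varepsilon<\varepsilon_0$ and $N\in\mathbb{N}$ satisfies $\varepsilon\log N\ge M$, one has $$P_{AC}(N,1+\varepsilon)\ge \exp\left(\frac{\alpha\,\big(\log\log N^{\varepsilon}\big)^2}{\log\log\log N^{\varepsilon}}\right).$$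
   Context: $N\times N$ complex matrices act on the Hilbert space $\mathbb{C}^N$ with the Euclidean norm, and $\|\cdot\|$ of a matrix is the operator norm. A bounded operator $T$ on a Hilbert space $H$ is absolutely Cesàro bounded with constant at most $K$ if $$\sup_{n\in\mathbb{N}}\frac1n\sum_{j=1}^n\|T^jx\|\le K\|x\|\quad\text{for all }x\in H.$$ Here $\log N^{\varepsilon}=\varepsilon\log N$. *)

theory Defs
  imports
    "HOL-Analysis.L2_Norm"
    "HOL-Library.Extended_Real"
    "Jordan_Normal_Form.Matrix"
begin

definition vec_l2_norm :: "complex vec \<Rightarrow> real" where
  "vec_l2_norm v = L2_set (\<lambda>i. cmod (v $ i)) {..<dim_vec v}"

definition mat_op_norm :: "complex mat \<Rightarrow> real" where
  "mat_op_norm A =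
     (SUP v\<in>{v \<in> carrier_vec (dim_col A). vec_l2_norm v \<le> 1}. vec_l2_norm (A *\<^sub>v v))"

text \<open>The suprema below are taken in the extended reals, where they exist without any boundedness
  side condition (a real-valued \<^const>\<open>Sup\<close> of an unbounded set would be an unspecified number).\<close>

definition abs_cesaro_bounded :: "real \<Rightarrow> complex mat \<Rightarrow> bool" where
  "abs_cesaro_bounded K A \<longleftrightarrow>
     (\<forall>x \<in> carrier_vec (dim_col A).
        (SUP n\<in>{1::nat..}. ereal (1 / real n * (\<Sum>j=1..n. vec_l2_norm ((A ^\<^sub>m j) *\<^sub>v x))))
          \<le> ereal (K * vec_l2_norm x))"

definition P_AC :: "nat \<Rightarrow> real \<Rightarrow> ereal" where
  "P_AC N K =
     (SUP A\<in>{A \<in> carrier_mat N N. abs_cesaro_bounded K A}.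
        SUP n\<in>{1::nat..}. ereal (mat_op_norm (A ^\<^sub>m n)))"

end

theory Submission
  imports Defs "HOL-Analysis.Convex"
begin

text \<open>
  Both lower bounds follow from a single family of matrices, whose powers even grow like a power
  of \<open>N\<close>. Let \<open>T\<close> be the weighted backward shift \<open>T e\<^sub>k = (k / (k - 1))\<^sup>a e\<^bsub>k-1\<^esub>\<close>, \<open>T e\<^sub>1 = 0\<close>, with
  \<open>0 \<le> a < 1/2\<close>. The weights telescope, so \<open>T\<^sup>j e\<^sub>k = (k / (k - j))\<^sup>a e\<^bsub>k-j\<^esub>\<close> for \<open>j < k\<close> and
  \<open>\<parallel>T\<^bsup>N-1\<^esup>\<parallel> \<ge> N\<^sup>a\<close>. Distinct basis vectors stay orthogonal under \<open>T\<^sup>j\<close>. By Cauchy--Schwarz the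
  Cesaro means of \<open>\<parallel>T\<^sup>j x\<parallel>\<close> are at most the root of the Cesaro means of \<open>\<parallel>T\<^sup>j x\<parallel>\<^sup>2\<close>, and the
  latter need to be bounded on basis vectors only (\<open>sum_norm_shift_power_power2_le\<close>). There they are
  averages of \<open>(k / (k - j))\<^bsup>2a\<^esup>\<close>, and comparison with the integral of \<open>t\<^bsup>-2a\<^esup>\<close> bounds them by
  \<open>2\<^bsup>2a\<^esup> / (1 - 2a)\<close> (\<open>sum_ratio_powr_le\<close>).

  This constant tends to \<open>1\<close> as \<open>a \<rightarrow> 0\<close>; for \<open>a = \<epsilon>/4\<close> with \<open>\<epsilon> \<le> 1\<close> it is at most \<open>(1 + \<epsilon>)\<^sup>2\<close>.
  Hence \<open>P_AC N (1 + \<epsilon>) \<ge> N\<^bsup>\<epsilon>/4\<^esup>\<close> (\<open>P_AC_ge_powr\<close>). For fixed \<open>\<epsilon>\<close> this beats every power of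
  \<open>log N\<close>. With \<open>L = log log N\<^sup>\<epsilon>\<close> it equals \<open>exp (exp L / 4)\<close>, which is at least
  \<open>exp (\<alpha> L\<^sup>2 / log L)\<close> as soon as \<open>log L \<ge> 1\<close>, because \<open>\<alpha> < 1/4\<close> and \<open>L\<^sup>2 \<le> exp L\<close>.
\<close>

section \<open>Averages of powers of ratios\<close>

text \<open>Weighted AM--GM for the numbers \<open>x - 1\<close> and \<open>x\<close>: the discrete form of comparing
  \<open>x\<^bsup>-b\<^esup>\<close> with the integral of \<open>t\<^bsup>-b\<^esup>\<close> over \<open>[x - 1, x]\<close>.\<close>

lemma powr_minus_le_powr_diff:
  fixes b x :: real
  assumes "0 \<le> b" "b < 1" "1 \<le> x"
  shows "(1 - b) * x powr (- b) \<le> x powr (1 - b) - (x - 1) powr (1 - b)"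
proof -
  have "(x - 1) powr (1 - b) * x powr b \<le> (1 - b) * (x - 1) + b * x"
  proof (cases "x = 1")
    case True
    then show ?thesis using assms by simp
  next
    case False
    then show ?thesis
      using Youngs_inequality_0[of "1 - b" b "x - 1" x] assms by simp
  qed
  then have "(x - 1) powr (1 - b) * x powr b * x powr (- b) \<le> (x - (1 - b)) * x powr (- b)"
    by (intro mult_right_mono) (auto simp: algebra_simps)
  moreover have "(x - 1) powr (1 - b) * x powr b * x powr (- b) = (x - 1) powr (1 - b)"
    using assms by (simp add: powr_add[symmetric] mult.assoc)
  ultimately have "(x - 1) powr (1 - b) \<le> x * x powr (- b) - (1 - b) * x powr (- b)"
    by (simp add: left_diff_distrib)
  moreover have "x * x powr (- b) = x powr (1 - b)"
    using assms powr_add[of x 1 "- b"] by simp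
  ultimately show ?thesis
    by linarith
qed

text \<open>The average over all \<open>j \<le> k\<close> is controlled by the integral comparison; the average over fewer
  terms is no larger, since the terms increase with \<open>j\<close>. In the telescoped form this monotonicity
  is the inequality \<open>t \<le> t\<^bsup>1-b\<^esup>\<close> for \<open>t = (k - m) / k\<close>. The factor \<open>2\<^sup>b\<close> pays for replacing
  \<open>k + 1\<close> by \<open>k\<close> in the numerator.\<close>

lemma sum_ratio_powr_le:
  fixes b :: real
  assumes b: "0 \<le> b" "b < 1" and mk: "m \<le> k"
  shows "(\<Sum>j=1..m. ((real k + 1) / (real k + 1 - real j)) powr b)
           \<le> real m * (2 powr b / (1 - b))"
proof (cases "m = 0")
  case False
  then have k: "0 < real k" using mk by linarith
  have telescope: "(1 - b) * (\<Sum>j=1..m. (real k + 1 - real j) powr (- b))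
                     \<le> real k powr (1 - b) - (real k - real m) powr (1 - b)"
    using mk
  proof (induction m)
    case (Suc m)
    have "(1 - b) * (real k - real m) powr (- b)
            \<le> (real k - real m) powr (1 - b) - (real k - real m - 1) powr (1 - b)"
      using Suc.prems by (intro powr_minus_le_powr_diff b) linarith
    then show ?case
      using Suc by (simp add: algebra_simps)
  qed simp
  define t where "t = (real k - real m) / real k"
  have t: "0 \<le> t" "t \<le> 1" using mk k by (auto simp: t_def field_simps)
  have "t \<le> t powr (1 - b)"
  proof (cases "t = 0")
    case False
    then show ?thesis using t b powr_mono'[of "1 - b" 1 t] by simp
  qed simp
  moreover have "(real k - real m) powr (1 - b) = real k powr (1 - b) * t powr (1 - b)"
    using k mk by (simp add: t_def powr_divide)
  ultimately have "real k powr (1 - b) - (real k - real m) powr (1 - b)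
                     \<le> real k powr (1 - b) * (1 - t)"
    by (simp add: right_diff_distrib mult_left_mono)
  also have "\<dots> = real m * real k powr (- b)"
    using k by (simp add: t_def powr_diff powr_minus field_simps)
  finally have "(1 - b) * (\<Sum>j=1..m. (real k + 1 - real j) powr (- b)) \<le> real m * real k powr (- b)"
    using telescope by linarith
  then have bound: "(\<Sum>j=1..m. (real k + 1 - real j) powr (- b)) \<le> real m * real k powr (- b) / (1 - b)"
    using b by (simp add: field_simps)
  have "((real k + 1) / real k) powr b \<le> 2 powr b"
    using k b by (intro powr_mono2) (auto simp: field_simps)
  then have shift: "(real k + 1) powr b * real k powr (- b) \<le> 2 powr b"
    using k by (simp add: powr_divide powr_minus flip: divide_inverse)
  have "(\<Sum>j=1..m. ((real k + 1) / (real k + 1 - real j)) powr b)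
          = (real k + 1) powr b * (\<Sum>j=1..m. (real k + 1 - real j) powr (- b))"
    unfolding sum_distrib_left
    using mk by (intro sum.cong) (simp_all add: powr_divide powr_minus_divide)
  also have "\<dots> \<le> (real k + 1) powr b * (real m * real k powr (- b) / (1 - b))"
    by (intro mult_left_mono bound) simp
  also have "\<dots> = real m / (1 - b) * ((real k + 1) powr b * real k powr (- b))"
    by simp
  also have "\<dots> \<le> real m / (1 - b) * 2 powr b"
    using b by (intro mult_left_mono shift) simp
  finally show ?thesis by simp
qed simp

section \<open>The weighted shift and its powers\<close>

text \<open>Matrix indices start at \<open>0\<close>, so the basis vector called \<open>e\<^sub>k\<close> above sits at index \<open>k - 1\<close>.\<close>

definition ratio_shift :: "real \<Rightarrow> nat \<Rightarrow> complex mat" where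
  "ratio_shift a N =
     mat N N (\<lambda>(i, j). if j = Suc i then of_real (((real i + 2) / (real i + 1)) powr a) else 0)"

lemma ratio_shift_carrier [simp]: "ratio_shift a N \<in> carrier_mat N N"
  and ratio_shift_dim [simp]: "dim_row (ratio_shift a N) = N" "dim_col (ratio_shift a N) = N"
  by (simp_all add: ratio_shift_def)

lemma ratio_shift_mult_vec_index:
  assumes "x \<in> carrier_vec N" "i < N"
  shows "(ratio_shift a N *\<^sub>v x) $ i =
           (if Suc i < N then of_real (((real i + 2) / (real i + 1)) powr a) * x $ Suc i else 0)"
proof -
  have "(ratio_shift a N *\<^sub>v x) $ i =
          (\<Sum>j\<in>{0..<N}. (if j = Suc i
             then of_real (((real i + 2) / (real i + 1)) powr a) else 0) * x $ j)"
    using assms by (simp add: ratio_shift_def scalar_prod_def)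
  also have "\<dots> = (\<Sum>j\<in>{0..<N}. if j = Suc i
             then of_real (((real i + 2) / (real i + 1)) powr a) * x $ Suc i else 0)"
    by (intro sum.cong) auto
  finally have "(ratio_shift a N *\<^sub>v x) $ i =
          (\<Sum>j\<in>{0..<N}. if j = Suc i
             then of_real (((real i + 2) / (real i + 1)) powr a) * x $ Suc i else 0)" .
  then show ?thesis by simp
qed

lemma ratio_shift_power_mult_vec_index:
  assumes "x \<in> carrier_vec N" "i < N"
  shows "((ratio_shift a N ^\<^sub>m n) *\<^sub>v x) $ i =
           (if i + n < N
            then of_real (((real i + real n + 1) / (real i + 1)) powr a) * x $ (i + n) else 0)"
  using assms
proof (induction n arbitrary: x)
  case 0
  then show ?case by simp
next
  case (Suc n)
  have dim: "ratio_shift a N *\<^sub>v x \<in> carrier_vec N"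
    by (rule mult_mat_vec_carrier[OF ratio_shift_carrier Suc.prems(1)])
  define p where "p = ((real i + real n + 1) / (real i + 1)) powr a"
  define q where "q = ((real (i + n) + 2) / (real (i + n) + 1)) powr a"
  have "real i + real n + 1 \<noteq> 0" by linarith
  then have "(real i + real n + 1) / (real i + 1) * ((real (i + n) + 2) / (real (i + n) + 1))
          = (real i + real (Suc n) + 1) / (real i + 1)"
    by (simp add: add.assoc add.commute[of 2 "real n"])
  then have pq: "p * q = ((real i + real (Suc n) + 1) / (real i + 1)) powr a"
    by (simp only: p_def q_def flip: powr_mult)
  have "(ratio_shift a N ^\<^sub>m Suc n) *\<^sub>v x = (ratio_shift a N ^\<^sub>m n) *\<^sub>v (ratio_shift a N *\<^sub>v x)"
    using assoc_mult_mat_vec[OF pow_carrier_mat[OF ratio_shift_carrier] ratio_shift_carrier Suc.prems(1)]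
    by simp
  then have "((ratio_shift a N ^\<^sub>m Suc n) *\<^sub>v x) $ i =
          (if i + n < N then of_real p * (ratio_shift a N *\<^sub>v x) $ (i + n) else 0)"
    using Suc.IH[OF dim Suc.prems(2)] by (simp only: p_def)
  also have "\<dots> = (if i + Suc n < N then of_real p * (of_real q * x $ (i + Suc n)) else 0)"
    using ratio_shift_mult_vec_index[OF Suc.prems(1), of "i + n" a, folded q_def]
    by (simp del: index_mult_mat_vec)
  also have "\<dots> = (if i + Suc n < N then of_real (p * q) * x $ (i + Suc n) else 0)"
    by simp
  finally show ?case
    by (simp only: pq)
qed

lemma vec_l2_norm_nonneg [simp]: "0 \<le> vec_l2_norm v"
  by (simp add: vec_l2_norm_def)

lemma vec_l2_norm_power2: "(vec_l2_norm v)\<^sup>2 = (\<Sum>i<dim_vec v. (cmod (v $ i))\<^sup>2)"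
  by (simp add: vec_l2_norm_def L2_set_def sum_nonneg)

lemma norm_ratio_shift_power_power2:
  assumes x: "x \<in> carrier_vec N"
  shows "(vec_l2_norm ((ratio_shift a N ^\<^sub>m n) *\<^sub>v x))\<^sup>2 =
           (\<Sum>k\<in>{n..<N}. ((real k + 1) / (real k + 1 - real n)) powr (2 * a) * (cmod (x $ k))\<^sup>2)"
proof -
  have sq: "(r powr a)\<^sup>2 = r powr (2 * a)" for r :: real
    by (simp only: power2_eq_square mult_2 powr_add)
  have "(vec_l2_norm ((ratio_shift a N ^\<^sub>m n) *\<^sub>v x))\<^sup>2 =
          (\<Sum>i<N. if i + n < N
             then ((real i + real n + 1) / (real i + 1)) powr (2 * a) * (cmod (x $ (i + n)))\<^sup>2 else 0)"
    unfolding vec_l2_norm_power2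
    using x by (intro sum.cong)
      (auto simp: ratio_shift_power_mult_vec_index norm_mult power_mult_distrib sq
            simp del: index_mult_mat_vec)
  also have "\<dots> = (\<Sum>i\<in>{i. i + n < N}.
                ((real i + real n + 1) / (real i + 1)) powr (2 * a) * (cmod (x $ (i + n)))\<^sup>2)"
    by (intro sum.mono_neutral_cong_right) auto
  also have "\<dots> = (\<Sum>k\<in>{n..<N}. ((real k + 1) / (real k + 1 - real n)) powr (2 * a) * (cmod (x $ k))\<^sup>2)"
    by (rule sum.reindex_bij_witness[of _ "\<lambda>k. k - n" "\<lambda>i. i + n"]) (auto simp: of_nat_diff)
  finally show ?thesis .
qed

text \<open>Orthogonality turns the mean square of \<open>\<parallel>T\<^sup>j x\<parallel>\<close> into a combination of the mean squares along
  the basis vectors, each of which is an average of powers of ratios.\<close>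

lemma sum_norm_shift_power_power2_le:
  assumes a: "0 \<le> a" "a < 1 / 2" and x: "x \<in> carrier_vec N"
  shows "(\<Sum>j=1..n. (vec_l2_norm ((ratio_shift a N ^\<^sub>m j) *\<^sub>v x))\<^sup>2)
           \<le> real n * (2 powr (2 * a) / (1 - 2 * a)) * (vec_l2_norm x)\<^sup>2"
proof -
  define C where "C = 2 powr (2 * a) / (1 - 2 * a)"
  define w where "w = (\<lambda>k j. ((real k + 1) / (real k + 1 - real j)) powr (2 * a))"
  have C: "0 \<le> C" using a by (simp add: C_def)
  have "(\<Sum>j=1..n. (vec_l2_norm ((ratio_shift a N ^\<^sub>m j) *\<^sub>v x))\<^sup>2)
          = (\<Sum>j=1..n. \<Sum>k<N. if j \<le> k then w k j * (cmod (x $ k))\<^sup>2 else 0)"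
    unfolding norm_ratio_shift_power_power2[OF x] w_def
    by (intro sum.cong sum.mono_neutral_cong_left) auto
  also have "\<dots> = (\<Sum>k<N. \<Sum>j=1..n. if j \<le> k then w k j * (cmod (x $ k))\<^sup>2 else 0)"
    by (rule sum.swap)
  also have "\<dots> = (\<Sum>k<N. (\<Sum>j=1..min n k. w k j) * (cmod (x $ k))\<^sup>2)"
    unfolding sum_distrib_right
    by (intro sum.cong sum.mono_neutral_cong_right) auto
  also have "\<dots> \<le> (\<Sum>k<N. (real n * C) * (cmod (x $ k))\<^sup>2)"
  proof (intro sum_mono mult_right_mono)
    fix k
    have "(\<Sum>j=1..min n k. w k j) \<le> real (min n k) * C"
      unfolding w_def C_def using a by (intro sum_ratio_powr_le) auto
    also have "\<dots> \<le> real n * C"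
      using C by (intro mult_right_mono) auto
    finally show "(\<Sum>j=1..min n k. w k j) \<le> real n * C" .
  qed simp
  also have "\<dots> = real n * C * (vec_l2_norm x)\<^sup>2"
    using x by (simp add: vec_l2_norm_power2 sum_distrib_left)
  finally show ?thesis by (simp add: C_def)
qed

lemma sum_norm_shift_power_le:
  assumes a: "0 \<le> a" "a < 1 / 2" and x: "x \<in> carrier_vec N"
    and K: "0 \<le> K" "2 powr (2 * a) / (1 - 2 * a) \<le> K\<^sup>2"
  shows "(\<Sum>j=1..n. vec_l2_norm ((ratio_shift a N ^\<^sub>m j) *\<^sub>v x)) \<le> real n * (K * vec_l2_norm x)"
proof (rule power2_le_imp_le)
  have "(\<Sum>j=1..n. vec_l2_norm ((ratio_shift a N ^\<^sub>m j) *\<^sub>v x))\<^sup>2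
          \<le> (\<Sum>j=1..n. (vec_l2_norm ((ratio_shift a N ^\<^sub>m j) *\<^sub>v x))\<^sup>2) * real n"
    using sum_squared_le_sum_of_squares[of _ "{1..n}"] by simp
  also have "\<dots> \<le> (real n * (2 powr (2 * a) / (1 - 2 * a)) * (vec_l2_norm x)\<^sup>2) * real n"
    by (intro mult_right_mono sum_norm_shift_power_power2_le a x) simp
  also have "\<dots> \<le> (real n * K\<^sup>2 * (vec_l2_norm x)\<^sup>2) * real n"
    by (intro mult_right_mono mult_left_mono K) simp_all
  also have "\<dots> = (real n * (K * vec_l2_norm x))\<^sup>2"
    by (simp add: power2_eq_square)
  finally show "(\<Sum>j=1..n. vec_l2_norm ((ratio_shift a N ^\<^sub>m j) *\<^sub>v x))\<^sup>2 \<le> (real n * (K * vec_l2_norm x))\<^sup>2" .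
qed (use K in simp)

section \<open>From absolute Cesaro bounds to lower bounds for the supremum\<close>

lemma abs_cesaro_bounded_iff:
  "abs_cesaro_bounded K A \<longleftrightarrow>
     (\<forall>x\<in>carrier_vec (dim_col A). \<forall>n\<ge>1.
        (\<Sum>j=1..n. vec_l2_norm ((A ^\<^sub>m j) *\<^sub>v x)) \<le> real n * (K * vec_l2_norm x))"
proof -
  have "1 / real n * s \<le> c \<longleftrightarrow> s \<le> real n * c" if "1 \<le> n" for n and s c :: real
    using that by (simp add: field_simps)
  then show ?thesis
    by (auto simp: abs_cesaro_bounded_def SUP_le_iff)
qed

text \<open>The operator norm is a supremum of reals, so a single vector bounds it from below only once the
  supremum is known to be over a bounded set. The Cesaro bound itself supplies this: the last term of
  the sum up to \<open>n\<close> is at most the whole sum, hence \<open>\<parallel>A\<^sup>n x\<parallel> \<le> n K \<parallel>x\<parallel>\<close>.\<close>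

lemma P_AC_ge_norm_power:
  assumes A: "A \<in> carrier_mat N N" and K: "0 \<le> K" "abs_cesaro_bounded K A"
    and x: "x \<in> carrier_vec N" "vec_l2_norm x \<le> 1" and n: "1 \<le> n"
  shows "ereal (vec_l2_norm ((A ^\<^sub>m n) *\<^sub>v x)) \<le> P_AC N K"
proof -
  have dim: "dim_col (A ^\<^sub>m n) = N"
    using pow_carrier_mat[OF A, of n] by auto
  have "vec_l2_norm ((A ^\<^sub>m n) *\<^sub>v v) \<le> real n * K"
    if v: "v \<in> carrier_vec N" "vec_l2_norm v \<le> 1" for v
  proof -
    have "vec_l2_norm ((A ^\<^sub>m n) *\<^sub>v v) \<le> (\<Sum>j=1..n. vec_l2_norm ((A ^\<^sub>m j) *\<^sub>v v))"
      using n by (intro member_le_sum) auto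
    also have "\<dots> \<le> real n * (K * vec_l2_norm v)"
      using K(2) A v(1) n by (auto simp: abs_cesaro_bounded_iff)
    also have "\<dots> \<le> real n * (K * 1)"
      by (intro mult_left_mono v K) simp
    finally show ?thesis by simp
  qed
  then have "vec_l2_norm ((A ^\<^sub>m n) *\<^sub>v x) \<le> mat_op_norm (A ^\<^sub>m n)"
    unfolding mat_op_norm_def dim using x by (intro cSUP_upper) (auto intro!: bdd_aboveI2)
  moreover have "ereal (mat_op_norm (A ^\<^sub>m n)) \<le> P_AC N K"
    unfolding P_AC_def using A K(2) n by (intro SUP_upper2[of A] SUP_upper) auto
  ultimately show ?thesis
    by (meson ereal_less_eq(3) order_trans)
qed

lemma vec_l2_norm_unit_vec [simp]: "k < N \<Longrightarrow> vec_l2_norm (unit_vec N k) = 1"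
proof -
  assume k: "k < N"
  have "(vec_l2_norm (unit_vec N k))\<^sup>2 = (\<Sum>i<N. if i = k then 1 else 0)"
    unfolding vec_l2_norm_power2 using k by (intro sum.cong) auto
  then have "(vec_l2_norm (unit_vec N k))\<^sup>2 = 1\<^sup>2" using k by simp
  then show ?thesis by (rule power2_eq_imp_eq) simp_all
qed

lemma P_AC_ge_1:
  assumes "1 \<le> N" "1 \<le> K"
  shows "1 \<le> P_AC N K"
proof -
  have pow: "(1\<^sub>m N :: complex mat) ^\<^sub>m j = 1\<^sub>m N" for j
    by (induction j) auto
  have "abs_cesaro_bounded K (1\<^sub>m N)"
    unfolding abs_cesaro_bounded_iff pow
    using assms mult_right_mono[of 1 K "vec_l2_norm _"] by (auto intro!: mult_left_mono)
  then have "ereal (vec_l2_norm ((1\<^sub>m N ^\<^sub>m 1) *\<^sub>v unit_vec N 0)) \<le> P_AC N K"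
    using assms by (intro P_AC_ge_norm_power) auto
  then show ?thesis
    using assms by (simp add: one_ereal_def)
qed

text \<open>The witness is the last basis vector, which \<open>T\<^bsup>N-1\<^esup>\<close> carries to \<open>N\<^sup>a e\<^sub>1\<close>. The power of the
  matrix has to be positive, so dimension \<open>1\<close>, where the shift vanishes, is covered by the identity matrix.\<close>

lemma P_AC_ge_powr_of_constant:
  assumes a: "0 \<le> a" "a < 1 / 2" and K: "1 \<le> K" "2 powr (2 * a) / (1 - 2 * a) \<le> K\<^sup>2"
    and N: "1 \<le> N"
  shows "ereal (real N powr a) \<le> P_AC N K"
proof (cases "N = 1")
  case True
  then show ?thesis using P_AC_ge_1[of N K] N K by (simp add: one_ereal_def)
next
  case False
  define v where "v = (ratio_shift a N ^\<^sub>m (N - 1)) *\<^sub>v unit_vec N (N - 1)"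
  have "dim_vec v = N" by (simp add: v_def)
  moreover have "v $ 0 = of_real (real N powr a)"
    unfolding v_def using N by (subst ratio_shift_power_mult_vec_index) (auto simp: of_nat_diff)
  moreover have "cmod (v $ 0) \<le> vec_l2_norm v"
    unfolding vec_l2_norm_def by (rule member_le_L2_set) (use \<open>dim_vec v = N\<close> N in auto)
  ultimately have "real N powr a \<le> vec_l2_norm v"
    by simp
  moreover have "abs_cesaro_bounded K (ratio_shift a N)"
    unfolding abs_cesaro_bounded_iff
    by (intro ballI allI impI sum_norm_shift_power_le) (use a K in auto)
  then have "ereal (vec_l2_norm v) \<le> P_AC N K"
    unfolding v_def using N K False by (intro P_AC_ge_norm_power) auto
  ultimately show ?thesis
    by (meson ereal_less_eq(3) order_trans)
qed

lemma P_AC_mono: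
  assumes "K \<le> K'"
  shows "P_AC N K \<le> P_AC N K'"
proof -
  have "abs_cesaro_bounded K' A" if "abs_cesaro_bounded K A" for A
    unfolding abs_cesaro_bounded_iff
  proof (intro ballI allI impI)
    fix x :: "complex vec" and n assume "x \<in> carrier_vec (dim_col A)" "1 \<le> (n::nat)"
    then have "(\<Sum>j=1..n. vec_l2_norm ((A ^\<^sub>m j) *\<^sub>v x)) \<le> real n * (K * vec_l2_norm x)"
      using that by (auto simp: abs_cesaro_bounded_iff)
    also have "\<dots> \<le> real n * (K' * vec_l2_norm x)"
      by (intro mult_left_mono mult_right_mono assms) simp_all
    finally show "(\<Sum>j=1..n. vec_l2_norm ((A ^\<^sub>m j) *\<^sub>v x)) \<le> real n * (K' * vec_l2_norm x)" .
  qed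
  then show ?thesis
    unfolding P_AC_def by (intro SUP_subset_mono) auto
qed

lemma P_AC_ge_powr:
  assumes \<epsilon>: "0 < \<epsilon>" "\<epsilon> \<le> 1" and N: "1 \<le> N"
  shows "ereal (real N powr (\<epsilon> / 4)) \<le> P_AC N (1 + \<epsilon>)"
proof (rule P_AC_ge_powr_of_constant)
  (* Weighted AM--GM again: exponentials lie below their chords. *)
  have "2 powr (\<epsilon> / 2) \<le> 1 + \<epsilon>"
    using Youngs_inequality_0[of "\<epsilon> / 2" "1 - \<epsilon> / 2" 2 1] \<epsilon> by simp
  moreover have "1 / (1 - \<epsilon> / 2) \<le> 1 + \<epsilon>"
  proof -
    have "\<epsilon> * \<epsilon> \<le> \<epsilon> * 1" using \<epsilon> by (intro mult_left_mono) auto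
    then show ?thesis using \<epsilon> by (simp add: field_simps)
  qed
  ultimately have "2 powr (\<epsilon> / 2) * (1 / (1 - \<epsilon> / 2)) \<le> (1 + \<epsilon>) * (1 + \<epsilon>)"
    using \<epsilon> by (intro mult_mono) auto
  then show "2 powr (2 * (\<epsilon> / 4)) / (1 - 2 * (\<epsilon> / 4)) \<le> (1 + \<epsilon>)\<^sup>2"
    by (simp add: power2_eq_square)
qed (use assms in auto)

section \<open>Comparison of growth rates\<close>

lemma power_le_powr_of_ln:
  fixes x a :: real
  assumes "1 \<le> x" "0 \<le> a"
  shows "(a / (real m + 1)) ^ m * ln x ^ m \<le> x powr a"
proof -
  define y where "y = a * ln x / (real m + 1)"
  have y: "0 \<le> y" using assms by (simp add: y_def)
  have "(a / (real m + 1)) ^ m * ln x ^ m = y ^ m"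
    by (simp add: y_def flip: power_mult_distrib)
  also have "\<dots> \<le> exp y ^ m"
    using y exp_ge_add_one_self[of y] by (intro power_mono) linarith+
  also have "\<dots> \<le> exp y ^ Suc m"
    using y by (intro power_increasing) auto
  also have "\<dots> = exp (real (Suc m) * y)"
    by (rule exp_of_nat_mult[symmetric])
  also have "real (Suc m) * y = a * ln x"
    by (simp add: y_def add.commute[of 1 "real m"])
  also have "exp \<dots> = x powr a"
    using assms by (simp add: powr_def)
  finally show ?thesis .
qed

lemma power2_le_exp:
  fixes x :: real
  assumes "0 \<le> x"
  shows "x\<^sup>2 \<le> exp x"
proof -
  have "0 \<le> (x - 2)\<^sup>2" by simp
  then have "x \<le> 1 + x / 2 + (x / 2)\<^sup>2 / 2"
    by (simp add: power2_eq_square algebra_simps)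
  also have "\<dots> \<le> exp (x / 2)"
    using exp_lower_Taylor_quadratic[of "x / 2"] assms by simp
  finally have "x\<^sup>2 \<le> (exp (x / 2))\<^sup>2"
    using assms by (intro power_mono) auto
  also have "\<dots> = exp x"
    by (simp flip: exp_double)
  finally show ?thesis .
qed

theorem theorem1p2:
  shows "(\<forall>(\<epsilon>::real) (m::nat). \<epsilon> > 0 \<longrightarrow>
           (\<exists>C::real. C > 0 \<and>
              (\<forall>N::nat. N \<ge> 1 \<longrightarrow> P_AC N (1 + \<epsilon>) \<ge> ereal (C * ln (real N) ^ m))))
         \<and>
         (\<forall>\<alpha>::real. 0 < \<alpha> \<and> \<alpha> < 1 / 4 \<longrightarrow>
           (\<exists>(M::real) (\<epsilon>\<^sub>0::real). M > 0 \<and> 0 < \<epsilon>\<^sub>0 \<and> \<epsilon>\<^sub>0 \<le> 1 \<and>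
              (\<forall>(\<epsilon>::real) (N::nat).
                 0 < \<epsilon> \<and> \<epsilon> < \<epsilon>\<^sub>0 \<and> N \<ge> 1 \<and> \<epsilon> * ln (real N) \<ge> M \<longrightarrow>
                   P_AC N (1 + \<epsilon>) \<ge>
                     ereal (exp (\<alpha> * (ln (ln (real N powr \<epsilon>)))\<^sup>2
                                   / ln (ln (ln (real N powr \<epsilon>))))))))"
proof (intro conjI allI impI)
  fix \<epsilon> :: real and m :: nat
  assume \<epsilon>: "\<epsilon> > 0"
  define \<delta> where "\<delta> = min \<epsilon> 1"
  have \<delta>: "0 < \<delta>" "\<delta> \<le> 1" "\<delta> \<le> \<epsilon>" using \<epsilon> by (auto simp: \<delta>_def)
  define C where "C = (\<delta> / 4 / (real m + 1)) ^ m"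
  have "ereal (C * ln (real N) ^ m) \<le> P_AC N (1 + \<epsilon>)" if N: "N \<ge> 1" for N
  proof -
    have "ereal (C * ln (real N) ^ m) \<le> ereal (real N powr (\<delta> / 4))"
      unfolding C_def using power_le_powr_of_ln[of "real N" "\<delta> / 4" m] N \<delta> by simp
    also have "\<dots> \<le> P_AC N (1 + \<delta>)"
      by (rule P_AC_ge_powr) (use \<delta> N in auto)
    also have "\<dots> \<le> P_AC N (1 + \<epsilon>)"
      using \<delta> by (intro P_AC_mono) simp
    finally show ?thesis .
  qed
  moreover have "C > 0" using \<delta> by (simp add: C_def)
  ultimately show "\<exists>C>0. \<forall>N\<ge>1. ereal (C * ln (real N) ^ m) \<le> P_AC N (1 + \<epsilon>)"
    by blast
next
  fix \<alpha> :: real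
  assume \<alpha>: "0 < \<alpha> \<and> \<alpha> < 1 / 4"
  have bound: "ereal (exp (\<alpha> * (ln (ln (real N powr \<epsilon>)))\<^sup>2 / ln (ln (ln (real N powr \<epsilon>)))))
                 \<le> P_AC N (1 + \<epsilon>)"
    if \<epsilon>: "0 < \<epsilon>" "\<epsilon> < 1" and N: "N \<ge> 1" and M: "exp (exp 1) \<le> \<epsilon> * ln (real N)" for \<epsilon> N
  proof -
    define X where "X = ln (real N powr \<epsilon>)"
    define L where "L = ln X"
    have X_eq: "X = \<epsilon> * ln (real N)" using N by (simp add: X_def ln_powr)
    have X_pos: "0 < X" using M exp_gt_zero[of "exp 1"] unfolding X_eq by linarith
    have L_ge: "exp 1 \<le> L"
      using M X_pos unfolding L_def X_eq[symmetric] by (simp add: ln_ge_iff)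
    then have L_pos: "0 < L" using exp_gt_zero[of "1::real"] by linarith
    have lnL: "1 \<le> ln L" using L_ge L_pos by (simp add: ln_ge_iff)
    have "\<alpha> * L\<^sup>2 / ln L \<le> \<alpha> * L\<^sup>2 / 1"
      using lnL \<alpha> by (intro divide_left_mono) auto
    also have "\<dots> = \<alpha> * L\<^sup>2"
      by simp
    also have "\<dots> \<le> 1 / 4 * exp L"
      by (intro mult_mono power2_le_exp) (use \<alpha> L_pos in auto)
    also have "\<dots> = \<epsilon> / 4 * ln (real N)"
      using X_pos X_eq by (simp add: L_def)
    finally have "exp (\<alpha> * L\<^sup>2 / ln L) \<le> real N powr (\<epsilon> / 4)"
      using N by (simp add: powr_def)
    then have "ereal (exp (\<alpha> * L\<^sup>2 / ln L)) \<le> ereal (real N powr (\<epsilon> / 4))"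
      by simp
    also have "\<dots> \<le> P_AC N (1 + \<epsilon>)"
      by (rule P_AC_ge_powr) (use \<epsilon> N in auto)
    finally show ?thesis by (simp add: L_def X_def)
  qed
  (* This threshold makes the triple logarithm in the denominator at least 1. *)
  show "\<exists>M \<epsilon>\<^sub>0. M > 0 \<and> 0 < \<epsilon>\<^sub>0 \<and> \<epsilon>\<^sub>0 \<le> 1 \<and>
          (\<forall>\<epsilon> N. 0 < \<epsilon> \<and> \<epsilon> < \<epsilon>\<^sub>0 \<and> N \<ge> 1 \<and> \<epsilon> * ln (real N) \<ge> M \<longrightarrow>
             P_AC N (1 + \<epsilon>) \<ge>
               ereal (exp (\<alpha> * (ln (ln (real N powr \<epsilon>)))\<^sup>2 / ln (ln (ln (real N powr \<epsilon>))))))"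
    by (rule exI[of _ "exp (exp 1)"], rule exI[of _ 1]) (use bound in auto)
qed

end
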